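(* Let $k\geq 1$ and $\Delta$ be integers with $0\leq \Delta\leq \binom{k+2}{2}-1$, and let $l=\binom{k+2}{3}+\Delta$. Let $I\subset R=\mathbb{C}[x,y,z]$ be a $0$-dimensional Borel-fixed ideal of colength $l$, and let $x^{m_1}, y^{m_2}, z^{m_3}$ be the pure powers among its minimal monomial generators. Then $$T(I)\;\leq\;(2m_1+1)\,l-2\binom{m_1+2}{4},$$ where $T(I)=\dim_{\mathbb{C}}\mathrm{Hom}_R(I,R/I)$.
   Context: Let $R=\mathbb{C}[x,y,z]$. An ideal $I\subset R$ is $0$-dimensional if $R/I$ is Artinian; its colength is $\dim_{\mathbb{C}}R/I$. A monomial ideal $I$ is called Borel-fixed if for every minimal monomial generator $g$ of $I$: if $z\mid g$ then $xg/z\in I$ and $yg/z\in I$; and if $y\mid g$ then $xg/y\in I$. The number $T(I)=\dim_{\mathbb{C}}\mathrm{Hom}_R(I,R/I)$ is the dimension of the tangent space to $\mathrm{Hilb}^l(\mathbb{A}^3)$ at the point $[I]$. Convention: $\binom{m}{n}=0$ for integers $m<n$. *)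

theory Defs
  imports
    "HOL-Library.Poly_Mapping"
    "HOL-Library.Product_Plus"
    "HOL-Algebra.QuotRing"
    "Jordan_Normal_Form.VS_Connect"
begin

hide_const (open) Multiset.mult Modules.module Modules.module_hom

text \<open>
  The polynomial ring in three variables is the monoid algebra of the additive monoid of exponent
  triples: \<open>Poly_Mapping.single (a, b, c) u\<close> is $u\,x^a y^b z^c$, and the type class operations
  on \<open>\<Rightarrow>\<^sub>0\<close> are addition and convolution.
\<close>

type_synonym exponent = "nat \<times> nat \<times> nat"
type_synonym pol = "exponent \<Rightarrow>\<^sub>0 complex"

abbreviation polR :: "pol ring"
  where "polR \<equiv> class_ring"

abbreviation complexK :: "complex ring"
  where "complexK \<equiv> class_ring"

definition varX :: pol where "varX = Poly_Mapping.single (1, 0, 0) 1"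
definition varY :: pol where "varY = Poly_Mapping.single (0, 1, 0) 1"
definition varZ :: pol where "varZ = Poly_Mapping.single (0, 0, 1) 1"

definition monomials :: "pol set"
  where "monomials = {varX ^ a * varY ^ b * varZ ^ c | a b c. True}"


subsection \<open>Monomial and Borel-fixed ideals\<close>

definition monomial_ideal :: "pol set \<Rightarrow> bool"
  where "monomial_ideal I \<longleftrightarrow> (\<exists>A \<subseteq> monomials. I = genideal polR A)"

definition min_gens :: "pol set \<Rightarrow> pol set"
  where "min_gens I =
    {g \<in> monomials. g \<in> I \<and> (\<forall>h \<in> monomials. h \<in> I \<and> h dvd g \<longrightarrow> h = g)}"

definition borel_fixed :: "pol set \<Rightarrow> bool"
  where "borel_fixed I \<longleftrightarrow> monomial_ideal I \<and>
    (\<forall>g \<in> min_gens I. \<forall>h.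
      (g = varZ * h \<longrightarrow> varX * h \<in> I \<and> varY * h \<in> I) \<and>
      (g = varY * h \<longrightarrow> varX * h \<in> I))"


subsection \<open>Artinian rings\<close>

locale artinian_ring = ring +
  assumes descending_chain:
    "\<lbrakk>\<And>n. ideal (J n) R; \<And>n. J (Suc n) \<subseteq> J n\<rbrakk> \<Longrightarrow> \<exists>N. \<forall>n\<ge>N. J n = J (N::nat)"

definition zero_dimensional :: "pol set \<Rightarrow> bool"
  where "zero_dimensional I \<longleftrightarrow> ideal I polR \<and> artinian_ring (polR Quot I)"


subsection \<open>Modules\<close>

text \<open>
  The fields \<open>mult\<close> and \<open>one\<close> that a \<open>module\<close> record inherits from \<open>ring\<close> play no role in the
  module axioms; below they are filled in arbitrarily when there is no natural choice.
\<close>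

definition ideal_module :: "pol set \<Rightarrow> (pol, pol) module"
  where "ideal_module I =
    \<lparr>carrier = I, mult = (*), one = 1, zero = 0, add = (+), smult = (*)\<rparr>"

definition quot_module :: "pol set \<Rightarrow> (pol, pol set) module"
  where "quot_module I =
    \<lparr>carrier = carrier (polR Quot I), mult = mult (polR Quot I), one = one (polR Quot I),
     zero = zero (polR Quot I), add = add (polR Quot I),
     smult = (\<lambda>f A. (I +>\<^bsub>polR\<^esub> f) \<otimes>\<^bsub>polR Quot I\<^esub> A)\<rparr>"

text \<open>
  The constant \<open>module_hom\<close> does not constrain a map outside the carrier of its source.  The
  intersection with \<open>extensional\<close> makes each homomorphism a single element of the carrier.
\<close>

definition hom_module ::
  "('r, 'c) ring_scheme \<Rightarrow> ('r, 'm, 'd) module_scheme \<Rightarrow> ('r, 'n, 'e) module_scheme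
    \<Rightarrow> ('r, 'm \<Rightarrow> 'n) module"
  where "hom_module R M N =
    \<lparr>carrier = module_hom R M N \<inter> extensional (carrier M),
     mult = undefined, one = undefined,
     zero = (\<lambda>m\<in>carrier M. \<zero>\<^bsub>N\<^esub>),
     add = (\<lambda>f g. \<lambda>m\<in>carrier M. f m \<oplus>\<^bsub>N\<^esub> g m),
     smult = (\<lambda>r f. \<lambda>m\<in>carrier M. r \<odot>\<^bsub>N\<^esub> f m)\<rparr>"

text \<open>Restriction of scalars along the inclusion of the constants.\<close>

definition complex_space :: "(pol, 'm) module \<Rightarrow> (complex, 'm) module"
  where "complex_space M =
    \<lparr>carrier = carrier M, mult = mult M, one = one M, zero = zero M, add = add M,
     smult = (\<lambda>c v. Poly_Mapping.single 0 c \<odot>\<^bsub>M\<^esub> v)\<rparr>"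

definition colength :: "pol set \<Rightarrow> nat"
  where "colength I = vectorspace.dim complexK (complex_space (quot_module I))"

definition tangent_space :: "pol set \<Rightarrow> (complex, pol \<Rightarrow> pol set) module"
  where "tangent_space I =
    complex_space (hom_module polR (ideal_module I) (quot_module I))"

definition tangent_dim :: "pol set \<Rightarrow> nat"
  where "tangent_dim I = vectorspace.dim complexK (tangent_space I)"


subsection \<open>The structures above are vector spaces\<close>

lemma polR_cring: "cring polR"
  by (rule class_cring.is_cring)

lemma module_ideal_module:
  assumes "ideal I polR"
  shows "Module.module polR (ideal_module I)"
proof -
  interpret I: ideal I polR by fact
  have uminus: "- a \<in> I" if "a \<in> I" for a
    using I.a_inv_closed[OF that] by (simp add: class_ring_simps)
  show ?thesis
  proof (rule moduleI[OF polR_cring])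
    show "abelian_group (ideal_module I)"
    proof (rule abelian_groupI)
      fix x assume "x \<in> carrier (ideal_module I)"
      then show "\<exists>y\<in>carrier (ideal_module I). y \<oplus>\<^bsub>ideal_module I\<^esub> x = \<zero>\<^bsub>ideal_module I\<^esub>"
        using uminus by (intro bexI[of _ "- x"]) (auto simp: ideal_module_def)
    qed (use I.a_closed I.zero_closed in \<open>auto simp: ideal_module_def add_ac\<close>)
  qed (use I.I_l_closed in \<open>auto simp: ideal_module_def distrib_left distrib_right mult.assoc\<close>)
qed

lemma module_quot_module:
  assumes "ideal I polR"
  shows "Module.module polR (quot_module I)"
proof -
  interpret I: ideal I polR by fact
  interpret Q: cring "polR Quot I" by (rule I.quotient_is_cring[OF polR_cring])
  interpret h: ring_hom_ring polR "polR Quot I" "(+>\<^bsub>polR\<^esub>) I"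
    by (rule I.rcos_ring_hom_ring)
  have [simp]: "I +>\<^bsub>polR\<^esub> r \<in> carrier (polR Quot I)" for r
    using h.hom_closed by simp
  have [simp]: "I +>\<^bsub>polR\<^esub> (r + s) = (I +>\<^bsub>polR\<^esub> r) \<oplus>\<^bsub>polR Quot I\<^esub> (I +>\<^bsub>polR\<^esub> s)" for r s
    using h.hom_add[of r s] by simp
  have [simp]: "I +>\<^bsub>polR\<^esub> (r * s) = (I +>\<^bsub>polR\<^esub> r) \<otimes>\<^bsub>polR Quot I\<^esub> (I +>\<^bsub>polR\<^esub> s)" for r s
    using h.hom_mult[of r s] by simp
  have [simp]: "I +>\<^bsub>polR\<^esub> 1 = \<one>\<^bsub>polR Quot I\<^esub>"
    using h.hom_one by simp
  show ?thesis
  proof (rule moduleI[OF polR_cring])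
    show "abelian_group (quot_module I)"
    proof (rule abelian_groupI)
      fix x assume "x \<in> carrier (quot_module I)"
      then show "\<exists>y\<in>carrier (quot_module I). y \<oplus>\<^bsub>quot_module I\<^esub> x = \<zero>\<^bsub>quot_module I\<^esub>"
        by (intro bexI[of _ "\<ominus>\<^bsub>polR Quot I\<^esub> x"]) (auto simp: quot_module_def Q.l_neg)
    qed (auto simp: quot_module_def Q.a_ac)
  qed (auto simp: quot_module_def Q.l_distr Q.r_distr Q.m_assoc)
qed

lemma module_hom_module:
  assumes "Module.module R M" "Module.module R N"
  shows "Module.module R (hom_module R M N)"
proof -
  interpret M: Module.module R M by fact
  interpret N: Module.module R N by fact
  note defs = hom_module_def LinearCombinations.module_hom_def
  show ?thesis
  proof (rule moduleI)
    show "cring R" by (rule M.R.is_cring)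
    show "abelian_group (hom_module R M N)"
    proof (rule abelian_groupI)
      fix f assume f: "f \<in> carrier (hom_module R M N)"
      show "\<exists>g\<in>carrier (hom_module R M N).
          g \<oplus>\<^bsub>hom_module R M N\<^esub> f = \<zero>\<^bsub>hom_module R M N\<^esub>"
        using f
        by (intro bexI[of _ "\<lambda>m\<in>carrier M. \<ominus>\<^bsub>N\<^esub> f m"])
           (auto simp: defs Pi_iff N.minus_add N.smult_r_minus N.l_neg intro!: restrict_ext)
    next
      fix f assume "f \<in> carrier (hom_module R M N)"
      then show "\<zero>\<^bsub>hom_module R M N\<^esub> \<oplus>\<^bsub>hom_module R M N\<^esub> f = f"
        by (intro extensionalityI[of _ "carrier M"]) (auto simp: defs Pi_iff)
    qed (auto simp: defs Pi_iff N.a_ac N.smult_r_distr intro!: restrict_ext)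
  next
    fix f assume "f \<in> carrier (hom_module R M N)"
    then show "\<one>\<^bsub>R\<^esub> \<odot>\<^bsub>hom_module R M N\<^esub> f = f"
      by (intro extensionalityI[of _ "carrier M"]) (auto simp: defs Pi_iff)
  next
    fix r f assume "r \<in> carrier R" "f \<in> carrier (hom_module R M N)"
    then show "r \<odot>\<^bsub>hom_module R M N\<^esub> f \<in> carrier (hom_module R M N)"
      by (auto simp: defs Pi_iff N.smult_r_distr N.smult_assoc1[symmetric] M.R.m_comm)
  qed (auto simp: defs Pi_iff N.smult_l_distr N.smult_r_distr N.smult_assoc1 intro!: restrict_ext)
qed

lemma vectorspace_complex_space:
  assumes "Module.module polR M"
  shows "vectorspace complexK (complex_space M)"
proof -
  interpret M: Module.module polR M by fact
  have one: "Poly_Mapping.single 0 1 = (1 :: pol)"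
    by simp
  have add: "Poly_Mapping.single 0 (a + b) = (Poly_Mapping.single 0 a + Poly_Mapping.single 0 b :: pol)"
    for a b by (simp add: single_add)
  have mult: "Poly_Mapping.single 0 (a * b) = (Poly_Mapping.single 0 a * Poly_Mapping.single 0 b :: pol)"
    for a b by (simp add: mult_single)
  have l_distr: "(r + s) \<odot>\<^bsub>M\<^esub> v = r \<odot>\<^bsub>M\<^esub> v \<oplus>\<^bsub>M\<^esub> s \<odot>\<^bsub>M\<^esub> v" if "v \<in> carrier M" for r s v
    using M.smult_l_distr[of r s v] that by simp
  have assoc: "(r * s) \<odot>\<^bsub>M\<^esub> v = r \<odot>\<^bsub>M\<^esub> (s \<odot>\<^bsub>M\<^esub> v)" if "v \<in> carrier M" for r s v
    using M.smult_assoc1[of r s v] that by simp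
  have sone: "1 \<odot>\<^bsub>M\<^esub> v = v" if "v \<in> carrier M" for v
    using M.smult_one[of v] that by simp
  have "Module.module complexK (complex_space M)"
  proof (rule moduleI)
    show "cring complexK" by (rule class_cring.is_cring)
    show "abelian_group (complex_space M)"
    proof (rule abelian_groupI)
      fix x assume "x \<in> carrier (complex_space M)"
      then show "\<exists>y\<in>carrier (complex_space M). y \<oplus>\<^bsub>complex_space M\<^esub> x = \<zero>\<^bsub>complex_space M\<^esub>"
        by (intro bexI[of _ "\<ominus>\<^bsub>M\<^esub> x"]) (auto simp: complex_space_def M.l_neg)
    qed (auto simp: complex_space_def M.a_ac)
  qed (simp_all only: one add mult complex_space_def module.simps ring.simps partial_object.simps
        monoid.simps, simp_all add: l_distr assoc sone M.smult_r_distr del: single_one)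
  then show ?thesis
    by (simp add: vectorspace_def class_field)
qed

lemma vectorspace_quotient:
  "ideal I polR \<Longrightarrow> vectorspace complexK (complex_space (quot_module I))"
  by (intro vectorspace_complex_space module_quot_module)

lemma vectorspace_tangent_space:
  "ideal I polR \<Longrightarrow> vectorspace complexK (tangent_space I)"
  unfolding tangent_space_def
  by (intro vectorspace_complex_space module_hom_module module_ideal_module module_quot_module)

end

theory Submission
  imports Defs
begin

text \<open>
  A homomorphism \<open>\<phi>\<close> from a monomial ideal to its quotient ring is given by the coefficients
  \<open>c(u, v)\<close> of \<open>x\<^sup>v\<close> in \<open>\<phi>(x\<^sup>u)\<close>, with \<open>x\<^sup>u\<close> in the ideal and \<open>x\<^sup>v\<close> outside. Linearity over the
  polynomial ring makes \<open>c\<close> constant under simultaneous translation of \<open>u\<close> and \<open>v\<close>, and zero if \<open>v\<close>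
  can be pushed out of the positive octant while \<open>u\<close> stays in the ideal. Slice the ideal by the
  \<open>x\<close>-exponent into ideals \<open>I\<^sub>0 \<subseteq> I\<^sub>1 \<subseteq> \<dots>\<close> of two variables, of colengths \<open>l\<^sub>i\<close>. The component of
  \<open>\<phi>\<close> from the \<open>i\<close>-th to the \<open>j\<close>-th slice is determined by at most \<open>l\<^sub>i + l\<^sub>j\<close> of its coefficients,
  and summing over \<open>i \<le> m\<close> and \<open>j < m\<close> gives \<open>(2m + 1) l\<close>.

  Borel-fixedness says that the least degree \<open>d\<^sub>i\<close> of a monomial in \<open>I\<^sub>i\<close> is attained by a power of
  \<open>y\<close> and strictly decreases in \<open>i\<close>. For \<open>i \<le> j\<close> the vanishing of \<open>y^d\<^sub>j\<close> in the target
  saves \<open>(j - i + 1) choose 2\<close> coefficients. For \<open>j < i\<close> the restriction of \<open>\<phi>\<close> to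
  \<open>I\<^bsub>i-1\<^esub>\<close> is controlled by the previous slice, which saves \<open>(i - j) choose 2\<close> coefficients because
  \<open>y^d\<^bsub>i-1\<^esub>\<close> lies in \<open>I\<^bsub>i-1\<^esub>\<close>. Each of the two savings sums to \<open>(m + 2) choose 4\<close>.
\<close>

subsection \<open>Coefficients that determine a homomorphism\<close>

locale borel_staircase =
  fixes M :: "exponent set" and m n2 n3 :: nat
  assumes up: "u \<in> M \<Longrightarrow> u + w \<in> M"
    and Z_to_Y: "(i, p, Suc c) \<in> M \<Longrightarrow> (i, Suc p, c) \<in> M"
    and Y_to_X: "(i, Suc p, c) \<in> M \<Longrightarrow> (Suc i, p, c) \<in> M"
    and pure_X: "(i, 0, 0) \<in> M \<longleftrightarrow> m \<le> i"
    and pure_Y: "(0, n2, 0) \<in> M"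
    and pure_Z: "(0, 0, n3) \<in> M"
begin

definition ht :: "nat \<Rightarrow> nat \<Rightarrow> nat" where "ht i p = (LEAST c. (i, p, c) \<in> M)"
text \<open>This is \<open>d\<^sub>i\<close> from the overview: \<open>triangle_not_mem\<close>
  shows that no monomial of the slice has smaller degree.\<close>

definition wd :: "nat \<Rightarrow> nat" where "wd i = (LEAST p. (i, p, 0) \<in> M)"

lemma up': "(i, p, c) \<in> M \<Longrightarrow> i \<le> i' \<Longrightarrow> p \<le> p' \<Longrightarrow> c \<le> c' \<Longrightarrow> (i', p', c') \<in> M"
  using up[of "(i, p, c)" "(i' - i, p' - p, c' - c)"] by simp

lemma mem_iff_ht: "(i, p, c) \<in> M \<longleftrightarrow> ht i p \<le> c"
proof -
  have "(i, p, n3) \<in> M" using up'[OF pure_Z] by simp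
  then have "(i, p, ht i p) \<in> M" unfolding ht_def by (rule LeastI)
  then show ?thesis
    using up'[of i p "ht i p" i p c] by (auto simp: ht_def intro: Least_le)
qed

lemma mem_iff_wd: "(i, p, 0) \<in> M \<longleftrightarrow> wd i \<le> p"
proof -
  have "(i, n2, 0) \<in> M" using up'[OF pure_Y] by simp
  then have "(i, wd i, 0) \<in> M" unfolding wd_def by (rule LeastI)
  then show ?thesis
    using up'[of i "wd i" 0 i p 0] by (auto simp: wd_def intro: Least_le)
qed

lemma ht_antimono: "p \<le> q \<Longrightarrow> ht i q \<le> ht i p"
  using up'[of i p "ht i p" i q "ht i p"] by (simp add: mem_iff_ht)

lemma not_mem_less_wd: "(i, p, c) \<notin> M \<Longrightarrow> p < wd i"
  using up'[of i p 0 i p c] by (auto simp: mem_iff_wd not_le[symmetric])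

lemma not_mem_less_m: "(i, p, c) \<notin> M \<Longrightarrow> i < m"
  using up'[of i 0 0 i p c] by (auto simp: pure_X not_le[symmetric])

lemma finite_compl: "finite (- M)"
proof (rule finite_subset)
  show "- M \<subseteq> {..<m} \<times> {..<n2} \<times> {..<n3}"
    using up'[OF pure_Y] up'[OF pure_Z] not_mem_less_m by (fastforce simp: not_le[symmetric])
qed simp

text \<open>Borel moves trade each \<open>z\<close> for a \<open>y\<close> and would yield a pure
  power of \<open>y\<close> below \<open>wd i\<close>.\<close>

lemma triangle_not_mem:
  assumes "p + c < wd i"
  shows "(i, p, c) \<notin> M"
proof
  have slide: "(i, p, c) \<in> M \<Longrightarrow> (i, p + c, 0) \<in> M" for p
  proof (induction c arbitrary: p)
    case (Suc c)
    then show ?case using Suc.IH[of "Suc p"] Z_to_Y by simp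
  qed simp
  assume "(i, p, c) \<in> M"
  from slide[OF this] show False using assms by (simp add: mem_iff_wd)
qed

text \<open>Trading one \<open>y\<close> of \<open>y^(wd i)\<close> for an \<open>x\<close> lands in
  the next slice; \<open>i < m\<close> guarantees that there is a \<open>y\<close> to trade.\<close>

lemma wd_Suc_less:
  assumes "i < m"
  shows "wd (Suc i) < wd i"
proof -
  have "wd i \<noteq> 0" using assms pure_X[of i] mem_iff_wd[of i 0] by auto
  then obtain p where p: "wd i = Suc p" using not0_implies_Suc by blast
  then have "(i, Suc p, 0) \<in> M" by (simp add: mem_iff_wd)
  then have "(Suc i, p, 0) \<in> M" by (rule Y_to_X)
  then show ?thesis using p by (simp add: mem_iff_wd)
qed

lemma wd_diff: "i \<le> j \<Longrightarrow> j \<le> m \<Longrightarrow> wd j + (j - i) \<le> wd i"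
proof (induction j rule: dec_induct)
  case (step j)
  then show ?case using wd_Suc_less[of j] by simp
qed simp

section \<open>Counting points in slices\<close>

definition slice :: "nat \<Rightarrow> (nat \<times> nat) set" where
  "slice i = {(p, c). (i, p, c) \<notin> M}"

lemma finite_slice: "finite (slice i)"
proof (rule finite_subset)
  show "slice i \<subseteq> snd ` (- M)" by (force simp: slice_def)
qed (simp add: finite_compl)

lemma card_triangle: "card {(p, c). b \<le> p \<and> p + c < (w::nat)} = (w - b + 1) choose 2"
proof -
  have "{(p, c). b \<le> p \<and> p + c < w} = Sigma {b..<w} (\<lambda>p. {..<w - p})" by auto
  then have "card {(p, c). b \<le> p \<and> p + c < w} = (\<Sum>p\<in>{b..<w}. w - p)" by simp
  \<comment> \<open>Under \<open>k = w - p\<close> only \<open>k = 0\<close> has no counterpart, and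
    its term is zero. For \<open>w < b\<close> both sums vanish.\<close>
  also have "\<dots> = (\<Sum>k\<in>{..w - b}. k)"
    by (rule sum.reindex_bij_witness_not_neutral[where S'="{}" and T'="{0}" and i="\<lambda>k. w - k" and j="\<lambda>p. w - p"]) auto
  also have "\<dots> = (w - b + 1) choose 2"
    using sum_choose_upper[of 1 "w - b"] by (simp add: numeral_2_eq_2)
  finally show ?thesis .
qed

text \<open>From column \<open>b\<close> on, the slice still contains a full triangle of side
  \<open>wd i - b\<close>, by \<open>triangle_not_mem\<close>.\<close>

lemma card_slice_below:
  "card {x \<in> slice i. fst x < b} + ((wd i - b + 1) choose 2) \<le> card (slice i)"
proof -
  let ?T = "{(p, c). b \<le> p \<and> p + c < wd i}"
  have "?T \<subseteq> slice i" by (auto simp: slice_def dest: triangle_not_mem)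
  then have "finite ?T" using finite_slice finite_subset by blast
  then have "card {x \<in> slice i. fst x < b} + card ?T = card ({x \<in> slice i. fst x < b} \<union> ?T)"
    using finite_slice by (intro card_Un_disjoint[symmetric]) auto
  also have "\<dots> \<le> card (slice i)"
    using finite_slice \<open>?T \<subseteq> slice i\<close> by (intro card_mono) auto
  finally show ?thesis by (simp only: card_triangle)
qed

lemma card_slice_sum: "(\<Sum>i<m. card (slice i)) = card (- M)"
proof -
  have "- M = Sigma {..<m} slice"
    using not_mem_less_m by (auto simp: slice_def)
  then show ?thesis by (simp add: finite_slice)
qed

lemma slice_m: "slice m = {}"
  using not_mem_less_m by (auto simp: slice_def)

section \<open>Probes and their number\<close>

text \<open>
  \<open>probes_up\<close> treats the coefficients whose \<open>y\<close>-shift is nonnegative: they are pushed upwards in \<open>y\<close>,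
  and the ones recorded are those that cannot be pushed further because the target would enter \<open>M\<close>.
  \<open>probes_down\<close> treats negative \<open>y\<close>-shifts: these are pushed downwards in \<open>y\<close> until the target leaves
  the octant, after raising the \<open>z\<close>-exponent to the height of the preceding column, and the ones
  recorded are those for which this raise moves the target into \<open>M\<close>.
\<close>

definition probes_up :: "nat \<Rightarrow> nat \<Rightarrow> nat \<Rightarrow> (exponent \<times> exponent) set" where
  "probes_up i j b = {((i, p, ht i p), (j, q, t)) | p q t.
     p \<le> q \<and> p < b \<and> (j, q, t) \<notin> M \<and> (j, Suc q, t) \<in> M}"

definition probes_down :: "nat \<Rightarrow> nat \<Rightarrow> (exponent \<times> exponent) set" where
  "probes_down i j = {((i, p, ht i p), (j, q, t)) | p q t.
     q < p \<and> (j, q, t) \<notin> M \<and> (j, q, t + (ht i (p - 1) - ht i p)) \<in> M}"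

text \<open>For \<open>i \<le> j\<close> the bound \<open>wd j\<close> excludes nothing, because
  \<open>p \<le> q < wd j\<close>. For \<open>j < i\<close> the columns from
  \<open>wd (i - 1)\<close> on are left to the previous slice.\<close>

definition probes_between :: "nat \<Rightarrow> nat \<Rightarrow> (exponent \<times> exponent) set" where
  "probes_between i j = probes_up i j (if i \<le> j then wd j else wd (i - 1)) \<union> probes_down i j"

text \<open>Source column \<open>p\<close> and target row \<open>t\<close> identify a probe, as
  \<open>q\<close> is the last point of row \<open>t\<close> in slice \<open>j\<close>;
  \<open>p \<le> q\<close> keeps \<open>(p, t)\<close> in that slice.\<close>

lemma probes_up_card: "finite (probes_up i j b)" "card (probes_up i j b) \<le> card {x \<in> slice j. fst x < b}"
proof -
  let ?f = "\<lambda>(u :: exponent, v :: exponent). (fst (snd u), snd (snd v))"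
  have inj: "inj_on ?f (probes_up i j b)"
  proof -
    have "q = q'" if "(j, q, t) \<notin> M" "(j, Suc q, t) \<in> M" "(j, q', t) \<notin> M" "(j, Suc q', t) \<in> M"
      for q q' t
      using that up'[of j "Suc q" t j q' t] up'[of j "Suc q'" t j q t] by force
    then show ?thesis by (auto simp: inj_on_def probes_up_def)
  qed
  have sub: "?f ` probes_up i j b \<subseteq> {x \<in> slice j. fst x < b}"
    using up' by (fastforce simp: probes_up_def slice_def)
  have fin: "finite {x \<in> slice j. fst x < b}" using finite_slice by simp
  show "finite (probes_up i j b)" using inj_on_finite[OF inj sub fin] .
  show "card (probes_up i j b) \<le> card {x \<in> slice j. fst x < b}" using card_inj_on_le[OF inj sub fin] .
qed

text \<open>The distance of the target from the top of its column is stacked on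
  \<open>ht i p\<close>. The sum stays below \<open>ht i (p - 1)\<close>, hence below
  \<open>ht i q\<close>, which gives a point in column \<open>q\<close> of slice
  \<open>i\<close>.\<close>

lemma probes_down_card:
  "finite (probes_down i j)" "card (probes_down i j) \<le> card {x \<in> slice i. fst x < wd j}"
proof -
  let ?f = "\<lambda>(u :: exponent, v :: exponent).
    (fst (snd v), snd (snd u) + (ht j (fst (snd v)) - Suc (snd (snd v))))"
  have less: "ht i p + (ht j q - Suc t) < ht i (p - 1)"
    if "(j, q, t) \<notin> M" "(j, q, t + (ht i (p - 1) - ht i p)) \<in> M" for p q t
    using that ht_antimono[of "p - 1" p i] by (simp add: mem_iff_ht)
  have inj: "inj_on ?f (probes_down i j)"
  proof (rule inj_onI, clarsimp simp: probes_down_def)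
    fix q p t p' t'
    assume a: "q < p" "(j, q, t) \<notin> M" "(j, q, t + (ht i (p - Suc 0) - ht i p)) \<in> M"
      and a': "q < p'" "(j, q, t') \<notin> M" "(j, q, t' + (ht i (p' - Suc 0) - ht i p')) \<in> M"
      and eq: "ht i p + (ht j q - Suc t) = ht i p' + (ht j q - Suc t')"
    \<comment> \<open>The common value lies between \<open>ht i p\<close> and
      \<open>ht i (p - 1)\<close>, and likewise for \<open>p'\<close>; such intervals are disjoint
      for distinct columns.\<close>
    have "ht i p' < ht i (p - 1)" "ht i p < ht i (p' - 1)"
      using less[of q t p] less[of q t' p'] a a' eq by simp_all
    then have "\<not> p' \<le> p - 1" "\<not> p \<le> p' - 1"
      using ht_antimono not_le by blast+
    then have "p = p'" by simp
    then show "p = p' \<and> ht i p = ht i p' \<and> t = t'"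
      using eq a(2) a'(2) by (simp add: mem_iff_ht)
  qed
  have sub: "?f ` probes_down i j \<subseteq> {x \<in> slice i. fst x < wd j}"
  proof (clarsimp simp: probes_down_def slice_def mem_iff_ht[of i] not_le)
    fix p q t
    assume a: "q < p" "(j, q, t) \<notin> M" "(j, q, t + (ht i (p - Suc 0) - ht i p)) \<in> M"
    have "ht i (p - 1) \<le> ht i q" using a(1) by (intro ht_antimono) simp
    then show "ht i p + (ht j q - Suc t) < ht i q \<and> q < wd j"
      using less[of q t p] a not_mem_less_wd by force
  qed
  have fin: "finite {x \<in> slice i. fst x < wd j}" using finite_slice by simp
  show "finite (probes_down i j)" using inj_on_finite[OF inj sub fin] .
  show "card (probes_down i j) \<le> card {x \<in> slice i. fst x < wd j}"
    using card_inj_on_le[OF inj sub fin] .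
qed

lemma finite_probes_between: "finite (probes_between i j)"
  by (simp add: probes_between_def probes_up_card probes_down_card)

text \<open>For \<open>i \<le> j\<close> the down probes avoid the columns of slice \<open>i\<close>
  from \<open>wd j\<close> on; for \<open>j < i\<close> the up probes avoid those of slice
  \<open>j\<close> from \<open>wd (i - 1)\<close> on. \<open>wd_diff\<close> bounds the triangles
  there, over \<open>j - i\<close> and \<open>i - 1 - j\<close> steps respectively.\<close>

lemma card_probes_between:
  assumes "i \<le> m" "j < m"
  shows "card (probes_between i j) + (if i \<le> j then (j - i + 1) choose 2 else (i - j) choose 2)
    \<le> card (slice i) + card (slice j)"
proof -
  have le: "card (probes_between i j) \<le> card {x \<in> slice j. fst x < (if i \<le> j then wd j else wd (i - 1))}
      + card {x \<in> slice i. fst x < wd j}"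
    unfolding probes_between_def by (intro order.trans[OF card_Un_le] add_mono probes_up_card probes_down_card)
  have mono: "card {x \<in> slice i. fst x < b} \<le> card (slice i)" for i b
    using card_slice_below[of i b] by simp
  show ?thesis
  proof (cases "i \<le> j")
    case True
    then have "(j - i + 1) choose 2 \<le> (wd i - wd j + 1) choose 2"
      using assms wd_diff[of i j] by (intro binomial_right_mono) simp
    then show ?thesis
      using True le card_slice_below[of i "wd j"] mono[of j "wd j"] by simp
  next
    case False
    then have "(i - j) choose 2 \<le> (wd j - wd (i - 1) + 1) choose 2"
      using False wd_diff[of j "i - 1"] assms(1) by (intro binomial_right_mono) linarith
    then show ?thesis
      using False le card_slice_below[of j "wd (i - 1)"] mono[of i "wd j"] by simp
  qed
qed

text \<open>Sources include \<open>i = m\<close>, where \<open>x^m\<close> is a generator; beyond it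
  each source is \<open>x\<close> times an element of \<open>M\<close>. Targets have
  \<open>j < m\<close> because later slices are empty.\<close>

definition probes :: "(exponent \<times> exponent) set" where
  "probes = (\<Union>i\<le>m. \<Union>j<m. probes_between i j)"

lemma finite_probes: "finite probes"
  by (simp add: probes_def finite_probes_between)

lemma card_probes: "card probes + 2 * ((m + 2) choose 4) \<le> (2 * m + 1) * card (- M)"
proof -
  let ?d = "\<lambda>i j. if i \<le> j then (j - i + 1) choose 2 else (i - j) choose 2"
  have A: "(\<Sum>i\<le>j. (j - i + 1) choose 2) = (j + 2) choose 3" for j
  proof -
    have "(\<Sum>i\<le>j. (j - i + 1) choose 2) = (\<Sum>i\<le>j. (i + 1) choose 2)"
      by (rule sum.reindex_bij_witness[of _ "\<lambda>i. j - i" "\<lambda>i. j - i"]) auto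
    also have "\<dots> = (j + 2) choose 3"
      by (induction j) (simp_all add: numeral_2_eq_2 numeral_3_eq_3)
    finally show ?thesis .
  qed
  have B: "(\<Sum>j<i. (i - j) choose 2) = (i + 1) choose 3" for i
  proof (cases i)
    case (Suc k)
    then have "(\<Sum>j<i. (i - j) choose 2) = (\<Sum>j\<le>k. (k - j + 1) choose 2)"
      by (intro sum.cong) (auto simp: Suc_diff_le)
    then show ?thesis using A[of k] Suc by simp
  qed simp
  have C: "(\<Sum>j<k. (j + 2) choose 3) = (k + 2) choose 4" for k
    by (induction k) (simp_all add: eval_nat_numeral)
  have C': "(\<Sum>i\<le>m. (i + 1) choose 3) = (m + 2) choose 4"
    by (induction m) (simp_all add: eval_nat_numeral)
  \<comment> \<open>The pairs are split along the diagonal; in each half two hockey-stick sums give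
    one copy of the binomial.\<close>
  have "(\<Sum>i\<le>m. \<Sum>j<m. ?d i j) =
      (\<Sum>i\<le>m. \<Sum>j<m. if i \<le> j then (j - i + 1) choose 2 else 0) +
      (\<Sum>i\<le>m. \<Sum>j<m. if j < i then (i - j) choose 2 else 0)"
    unfolding sum.distrib[symmetric] by (intro sum.cong) auto
  also have "(\<Sum>i\<le>m. \<Sum>j<m. if i \<le> j then (j - i + 1) choose 2 else 0) =
      (\<Sum>j<m. \<Sum>i\<le>j. (j - i + 1) choose 2)"
    by (subst sum.swap) (intro sum.cong refl sum.mono_neutral_cong_right; simp)
  also have "(\<Sum>i\<le>m. \<Sum>j<m. if j < i then (i - j) choose 2 else 0) =
      (\<Sum>i\<le>m. \<Sum>j<i. (i - j) choose 2)"
    by (intro sum.cong refl sum.mono_neutral_cong_right; simp)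
  finally have d: "(\<Sum>i\<le>m. \<Sum>j<m. ?d i j) = 2 * ((m + 2) choose 4)"
    by (simp only: A B C C')
  have "card probes \<le> (\<Sum>i\<le>m. \<Sum>j<m. card (probes_between i j))"
    unfolding probes_def by (intro order.trans[OF card_UN_le] sum_mono) auto
  then have "card probes + 2 * ((m + 2) choose 4) \<le> (\<Sum>i\<le>m. \<Sum>j<m. card (probes_between i j) + ?d i j)"
    by (simp add: sum.distrib d)
  also have "\<dots> \<le> (\<Sum>i\<le>m. \<Sum>j<m. card (slice i) + card (slice j))"
    using card_probes_between by (intro sum_mono) simp
  also have "\<dots> = m * (\<Sum>i\<le>m. card (slice i)) + (m + 1) * (\<Sum>j<m. card (slice j))"
    by (simp add: sum.distrib sum_distrib_left)
  \<comment> \<open>The empty slice \<open>m\<close> drops out, so the weights \<open>m\<close> and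
    \<open>m + 1\<close> fall on the same sum.\<close>
  also have "(\<Sum>i\<le>m. card (slice i)) = (\<Sum>i<m. card (slice i))"
    by (simp add: lessThan_Suc_atMost[symmetric] slice_m)
  finally show ?thesis by (simp add: card_slice_sum algebra_simps)
qed

lemma probes_subset: "probes \<subseteq> M \<times> - M"
  by (auto simp: probes_def probes_between_def probes_up_def probes_down_def mem_iff_ht[of _ _ "ht _ _"])

end

section \<open>Vanishing on the probes forces vanishing everywhere\<close>

locale staircase_hom = borel_staircase +
  fixes g :: "exponent \<Rightarrow> exponent \<Rightarrow> 'a::zero"
  assumes shift: "u \<in> M \<Longrightarrow> v + w \<notin> M \<Longrightarrow> g (u + w) (v + w) = g u v"
    and boundary: "u \<in> M \<Longrightarrow> v \<notin> M \<Longrightarrow> (\<And>v'. v \<noteq> v' + w) \<Longrightarrow> g (u + w) v = 0"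
begin

lemma shift_X:
  assumes "(i, p, c) \<in> M" "(j, q, t) \<notin> M"
  shows "g (Suc i, p, c) (j, q, t) = (case j of 0 \<Rightarrow> 0 | Suc j' \<Rightarrow> g (i, p, c) (j', q, t))"
  using shift[of "(i, p, c)" "(j - 1, q, t)" "(1, 0, 0)"]
    boundary[of "(i, p, c)" "(j, q, t)" "(1, 0, 0)"] assms
  by (auto split: nat.split)

lemma shift_Y:
  assumes "(i, p, c) \<in> M" "(j, q, t) \<notin> M"
  shows "g (i, Suc p, c) (j, q, t) = (case q of 0 \<Rightarrow> 0 | Suc q' \<Rightarrow> g (i, p, c) (j, q', t))"
  using shift[of "(i, p, c)" "(j, q - 1, t)" "(0, 1, 0)"]
    boundary[of "(i, p, c)" "(j, q, t)" "(0, 1, 0)"] assms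
  by (auto split: nat.split)

lemma shift_Z:
  assumes "(i, p, c) \<in> M" "(j, q, t) \<notin> M"
  shows "g (i, p, c + d) (j, q, t) = (if d \<le> t then g (i, p, c) (j, q, t - d) else 0)"
  using shift[of "(i, p, c)" "(j, q, t - d)" "(0, 0, d)"]
    boundary[of "(i, p, c)" "(j, q, t)" "(0, 0, d)"] assms
  by auto

text \<open>Multiplying by \<open>y\<close> (if \<open>p \<le> q\<close>) or dividing by
  \<open>y\<close> (if \<open>q < p\<close>) walks through coefficients of equal value, until a
  probe is met or the value is seen to be zero.\<close>

lemma slice_zero:
  assumes upz: "\<And>p q t. p \<le> q \<Longrightarrow> (j, q, t) \<notin> M \<Longrightarrow> (j, Suc q, t) \<in> M
      \<Longrightarrow> g (i, p, ht i p) (j, q, t) = 0"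
    and downz: "\<And>p q t. q < p \<Longrightarrow> (j, q, t) \<notin> M \<Longrightarrow>
      (j, q, t + (ht i (p - 1) - ht i p)) \<in> M \<Longrightarrow> g (i, p, ht i p) (j, q, t) = 0"
    and mem: "(i, p, c) \<in> M" "(j, q, t) \<notin> M"
  shows "g (i, p, c) (j, q, t) = 0"
proof -
  \<comment> \<open>Above height \<open>ht i p\<close> a coefficient is a \<open>z\<close>-shift of
    one at that height, or zero if the target has too few factors \<open>z\<close>.\<close>
  have lower: "g (i, p, c) (j, q, t) = 0"
    if "(i, p, c) \<in> M" "(j, q, t) \<notin> M"
      and z: "\<And>t. (j, q, t) \<notin> M \<Longrightarrow> g (i, p, ht i p) (j, q, t) = 0" for p c q t
    using that(1,2) shift_Z[of i p "ht i p" j q t "c - ht i p"] z[of "t - (c - ht i p)"]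
    by (auto simp: mem_iff_ht)
  have "g (i, p, ht i p) (j, q, t) = 0" if "(j, q, t) \<notin> M" "p \<le> q" for p q t
    using that
  \<comment> \<open>Every target outside \<open>M\<close> has \<open>q < wd j\<close>, so the walk
    in \<open>y\<close> is bounded.\<close>
  proof (induction "wd j - q" arbitrary: p q t rule: less_induct)
    case less
    show ?case
    proof (cases "(j, Suc q, t) \<in> M")
      case False
      have "g (i, Suc p, ht i p) (j, Suc q, t) = 0"
      proof (rule lower)
        show "g (i, Suc p, ht i (Suc p)) (j, Suc q, t) = 0" if "(j, Suc q, t) \<notin> M" for t
          using less.hyps[of "Suc q" t "Suc p"] that less.prems(2) not_mem_less_wd[OF that] by simp
      qed (use False ht_antimono[of p "Suc p" i] in \<open>simp_all add: mem_iff_ht[of i]\<close>)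
      then show ?thesis using shift_Y[of i p "ht i p" j "Suc q" t] False by (simp add: mem_iff_ht)
    qed (rule upz[OF less.prems(2,1)])
  qed
  moreover have "g (i, p, ht i p) (j, q, t) = 0" if "(j, q, t) \<notin> M" "q < p" for p q t
    using that
  proof (induction q arbitrary: p t)
    case 0
    then show ?case
    proof (cases "(j, 0, t + (ht i (p - 1) - ht i p)) \<in> M")
      \<comment> \<open>Raised to the height of column \<open>p'\<close>, the source is
        \<open>y\<close> times an element of \<open>M\<close>, while the target has no factor
        \<open>y\<close>.\<close>
      case False
      obtain p' where p': "p = Suc p'" using 0 by (cases p) auto
      have "ht i p + (ht i p' - ht i p) = ht i p'" using ht_antimono[of p' p i] p' by simp
      then show ?thesis
        using shift[of "(i, p, ht i p)" "(j, 0, t)" "(0, 0, ht i p' - ht i p)"]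
          shift_Y[of i p' "ht i p'" j 0 "t + (ht i p' - ht i p)"] False p'
        by (simp add: mem_iff_ht)
    qed (rule downz[OF 0(2,1)])
  next
    case (Suc q)
    then show ?case
    proof (cases "(j, Suc q, t + (ht i (p - 1) - ht i p)) \<in> M")
      case False
      obtain p' where p': "p = Suc p'" using Suc by (cases p) auto
      have "ht i p + (ht i p' - ht i p) = ht i p'" using ht_antimono[of p' p i] p' by simp
      \<comment> \<open>After the same raise both sides can be divided by \<open>y\<close>, which
        preserves \<open>q < p\<close>.\<close>
      moreover have "g (i, p', ht i p') (j, q, t + (ht i p' - ht i p)) = 0"
        using Suc False p' up'[of j q _ j "Suc q"] by (intro Suc.IH) auto
      ultimately show ?thesis
        using shift[of "(i, p, ht i p)" "(j, Suc q, t)" "(0, 0, ht i p' - ht i p)"]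
          shift_Y[of i p' "ht i p'" j "Suc q" "t + (ht i p' - ht i p)"] False p'
        by (simp add: mem_iff_ht)
    qed (rule downz[OF Suc.prems(2,1)])
  qed
  ultimately have "g (i, p, ht i p) (j, q, t) = 0" if "(j, q, t) \<notin> M" for p q t
    using that not_le by blast
  then show ?thesis by (rule lower[OF mem])
qed

lemma probes_determine:
  assumes probes_zero: "\<And>u v. (u, v) \<in> probes \<Longrightarrow> g u v = 0"
    and "u \<in> M" "v \<notin> M"
  shows "g u v = 0"
proof -
  have dz: "g u v = 0" if "(u, v) \<in> probes_between i j" "i \<le> m" "j < m" for u v i j
    by (rule probes_zero) (use that in \<open>auto simp: probes_def\<close>)
  have "g (i, p, c) (j, q, t) = 0" if "(i, p, c) \<in> M" "(j, q, t) \<notin> M" for i p c j q t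
    using that
  proof (induction i arbitrary: p c j q t rule: less_induct)
    case (less i)
    have j: "j < m" using not_mem_less_m less.prems by blast
    show ?case
    proof (cases "i \<le> j")
      case True
      have "g (i, p, ht i p) (j, q, t) = 0"
        if "p \<le> q" "(j, q, t) \<notin> M" "(j, Suc q, t) \<in> M" for p q t
        using that True j not_mem_less_wd[OF that(2)]
        by (intro dz[of _ _ i j]) (auto simp: probes_between_def probes_up_def)
      moreover have "g (i, p, ht i p) (j, q, t) = 0"
        if "q < p" "(j, q, t) \<notin> M" "(j, q, t + (ht i (p - 1) - ht i p)) \<in> M" for p q t
        using that True j by (intro dz[of _ _ i j]) (auto simp: probes_between_def probes_down_def)
      ultimately show ?thesis using less.prems by (rule slice_zero)
    next
      case False
      then obtain i' where i: "i = Suc i'" by (cases i) auto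
      \<comment> \<open>The source is \<open>x\<close> times an element of the previous slice:
        dividing by \<open>x\<close> reaches the induction hypothesis, or gives zero when
        \<open>j = 0\<close>.\<close>
      have below: "g (i, p, c) (j, q, t) = 0" if "(i', p, c) \<in> M" "(j, q, t) \<notin> M" for p c q t
      proof (cases j)
        case (Suc j')
        then have "(j', q, t) \<notin> M" using that up'[of j' q t j q t] by auto
        then show ?thesis using less.IH[of i' p c j' q t] shift_X[OF that] that i Suc by simp
      qed (use shift_X[OF that] i in simp)
      show ?thesis
      proof (cases "i \<le> m")
        case True
        have "g (i, p, ht i p) (j, q, t) = 0"
          if "p \<le> q" "(j, q, t) \<notin> M" "(j, Suc q, t) \<in> M" for p q t
        proof (cases "p < wd i'")
          case True
          then show ?thesis using that False j \<open>i \<le> m\<close> i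
            by (intro dz[of _ _ i j]) (auto simp: probes_between_def probes_up_def)
        next
          \<comment> \<open>From column \<open>wd i'\<close> on, the previous slice of
            \<open>M\<close> is full, so \<open>below\<close> replaces the omitted up
            probes.\<close>
          case False
          then show ?thesis using that up'[of i' p 0 i' p "ht i p"]
            by (intro below) (auto simp: mem_iff_wd)
        qed
        moreover have "g (i, p, ht i p) (j, q, t) = 0"
          if "q < p" "(j, q, t) \<notin> M" "(j, q, t + (ht i (p - 1) - ht i p)) \<in> M" for p q t
          using that True j by (intro dz[of _ _ i j]) (auto simp: probes_between_def probes_down_def)
        ultimately show ?thesis using less.prems by (rule slice_zero)
      next
        case False
        then have "(i', p, c) \<in> M" using pure_X[of i'] up'[of i' 0 0 i' p c] i by simp
        then show ?thesis using below less.prems by blast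
      qed
    qed
  qed
  then show ?thesis using assms(2,3) by (cases u; cases v) auto
qed

end


subsection \<open>Separating functionals\<close>

definition linear_functional :: "('a::field, 'v) module \<Rightarrow> ('v \<Rightarrow> 'a) \<Rightarrow> bool" where
  "linear_functional V f \<longleftrightarrow>
    (\<forall>v\<in>carrier V. \<forall>w\<in>carrier V. f (v \<oplus>\<^bsub>V\<^esub> w) = f v + f w) \<and>
    (\<forall>c. \<forall>v\<in>carrier V. f (c \<odot>\<^bsub>V\<^esub> v) = c * f v)"

lemma linear_functional_lincomb:
  fixes V :: "('a::field, 'v) module"
  assumes "vectorspace class_ring V" "linear_functional V f" "finite S" "S \<subseteq> carrier V"
  shows "f (LinearCombinations.module.lincomb V a S) = (\<Sum>v\<in>S. a v * f v)"
proof -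
  interpret vectorspace class_ring V by fact
  have "f (\<zero>\<^bsub>V\<^esub> \<oplus>\<^bsub>V\<^esub> \<zero>\<^bsub>V\<^esub>) = f \<zero>\<^bsub>V\<^esub> + f \<zero>\<^bsub>V\<^esub>"
    using assms(2) M.zero_closed by (simp only: linear_functional_def)
  then have "f \<zero>\<^bsub>V\<^esub> = f \<zero>\<^bsub>V\<^esub> + f \<zero>\<^bsub>V\<^esub>" by (simp only: M.l_zero[OF M.zero_closed])
  then have zero: "f \<zero>\<^bsub>V\<^esub> = 0" by (metis add_cancel_right_right)
  show ?thesis using assms(3,4)
  proof (induction S)
    case (insert v S)
    have "lincomb a (insert v S) = a v \<odot>\<^bsub>V\<^esub> v \<oplus>\<^bsub>V\<^esub> lincomb a S"
      using insert by (intro lincomb_insert2) auto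
    moreover have "lincomb a S \<in> carrier V" "a v \<odot>\<^bsub>V\<^esub> v \<in> carrier V"
      using insert by auto
    ultimately show ?case using insert assms(2) by (simp add: linear_functional_def)
  qed (simp add: zero)
qed

lemma dim_ge_of_dual_family:
  fixes V :: "('a::field, 'v) module" and f :: "'d \<Rightarrow> 'v \<Rightarrow> 'a"
  assumes vs: "vectorspace class_ring V" and fd: "vectorspace.fin_dim class_ring V"
    and lin: "\<And>d. d \<in> D \<Longrightarrow> linear_functional V (f d)" and finD: "finite D"
    and e: "\<And>d. d \<in> D \<Longrightarrow> e d \<in> carrier V"
    and dual: "\<And>c d. c \<in> D \<Longrightarrow> d \<in> D \<Longrightarrow> f c (e d) = (if c = d then 1 else 0)"
  shows "card D \<le> vectorspace.dim class_ring V"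
proof -
  interpret vectorspace class_ring V by fact
  have inj: "inj_on e D"
    using dual by (metis inj_onI zero_neq_one)
  have sub: "e ` D \<subseteq> carrier V" using e by auto
  have "lin_indpt (e ` D)"
  proof (rule finite_lin_indpt2)
    fix a assume a: "lincomb a (e ` D) = \<zero>\<^bsub>V\<^esub>"
    have "a (e d) = 0" if d: "d \<in> D" for d
    proof -
      have "f d (lincomb a (e ` D)) = (\<Sum>v\<in>e ` D. a v * f d v)"
        using vs lin[OF d] finD sub by (intro linear_functional_lincomb) auto
      also have "\<dots> = (\<Sum>c\<in>D. a (e c) * f d (e c))"
        using inj by (simp add: sum.reindex)
      also have "\<dots> = (\<Sum>c\<in>D. if c = d then a (e d) else 0)"
        using d dual by (intro sum.cong) auto
      also have "\<dots> = a (e d)" using finD d by simp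
      \<comment> \<open>The zero vector is written as the empty combination so that
        \<open>linear_functional_lincomb\<close> evaluates \<open>f d\<close> on it.\<close>
      finally have "a (e d) = f d (lincomb a {})" using a by simp
      also have "\<dots> = 0" using vs lin[OF d] by (subst linear_functional_lincomb) auto
      finally show ?thesis .
    qed
    then show "\<forall>v\<in>e ` D. a v = \<zero>\<^bsub>class_ring\<^esub>" by simp
  qed (use finD sub in auto)
  then have "card (e ` D) \<le> dim" using fd sub by (intro li_le_dim)
  then show ?thesis using inj by (simp add: card_image)
qed

text \<open>Passing to the kernel of one functional costs at most one spanning vector. The induction
  runs over subsets \<open>W\<close> closed under the operations, since it continues inside
  kernels.\<close>

lemma dim_le_of_separating_functionals:
  fixes V :: "('a::field, 'v) module" and f :: "'d \<Rightarrow> 'v \<Rightarrow> 'a"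
  assumes vs: "vectorspace class_ring V"
    and lin: "\<And>d. d \<in> D \<Longrightarrow> linear_functional V (f d)" and finD: "finite D"
    and sep: "\<And>v. v \<in> carrier V \<Longrightarrow> (\<And>d. d \<in> D \<Longrightarrow> f d v = 0) \<Longrightarrow> v = \<zero>\<^bsub>V\<^esub>"
  shows "vectorspace.fin_dim class_ring V" "vectorspace.dim class_ring V \<le> card D"
proof -
  interpret vectorspace class_ring V by fact
  have span: "\<exists>B. finite B \<and> card B \<le> card D \<and> B \<subseteq> W \<and> W \<subseteq> span B"
    if "finite D" "\<And>d. d \<in> D \<Longrightarrow> linear_functional V (f d)" "W \<subseteq> carrier V"
      "\<And>v w. v \<in> W \<Longrightarrow> w \<in> W \<Longrightarrow> v \<oplus>\<^bsub>V\<^esub> w \<in> W" "\<And>c v. v \<in> W \<Longrightarrow> c \<odot>\<^bsub>V\<^esub> v \<in> W"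
      "\<And>v. v \<in> W \<Longrightarrow> (\<And>d. d \<in> D \<Longrightarrow> f d v = 0) \<Longrightarrow> v = \<zero>\<^bsub>V\<^esub>" for D and W :: "'v set"
    using that
  proof (induction D arbitrary: W)
    case empty
    then have "W \<subseteq> span {}" by (auto simp: span_empty)
    then show ?case by (intro exI[of _ "{}"]) auto
  next
    case (insert d D)
    note WV = insert.prems(2) and add = insert.prems(3) and smult = insert.prems(4)
    have fd: "f d (v \<oplus>\<^bsub>V\<^esub> w) = f d v + f d w" "f d (c \<odot>\<^bsub>V\<^esub> v) = c * f d v"
      if "v \<in> W" "w \<in> W" for v w c
      using that insert.prems(1)[of d] WV by (auto simp: linear_functional_def subset_iff)
    let ?W = "{w \<in> W. f d w = 0}"
    have "\<exists>B. finite B \<and> card B \<le> card D \<and> B \<subseteq> ?W \<and> ?W \<subseteq> span B"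
    proof (rule insert.IH)
      show "v = \<zero>\<^bsub>V\<^esub>" if "v \<in> ?W" "\<And>d. d \<in> D \<Longrightarrow> f d v = 0" for v
        using that insert.prems(5)[of v] by auto
    qed (use insert.prems(1) WV add smult fd in auto)
    then obtain B where B: "finite B" "card B \<le> card D" "B \<subseteq> ?W" "?W \<subseteq> span B" by blast
    show ?case
    proof (cases "W = ?W")
      case True
      then show ?thesis using B insert.hyps by (intro exI[of _ B]) auto
    next
      case False
      then obtain w0 where w0: "w0 \<in> W" "f d w0 \<noteq> 0" by blast
      have BV: "insert w0 B \<subseteq> carrier V" using B(3) w0(1) WV by auto
      interpret S: LinearCombinations.submodule class_ring "span (insert w0 B)" V
        by (rule span_is_submodule[OF BV])
      have "w \<in> span (insert w0 B)" if w: "w \<in> W" for w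
      proof -
        \<comment> \<open>This multiple of \<open>w0\<close> corrects \<open>w\<close> to lie in the
          kernel of \<open>f d\<close>.\<close>
        define c where "c = f d w / f d w0"
        have "w \<oplus>\<^bsub>V\<^esub> (- c) \<odot>\<^bsub>V\<^esub> w0 \<in> ?W"
          using w w0 add smult fd by (simp add: c_def)
        then have "w \<oplus>\<^bsub>V\<^esub> (- c) \<odot>\<^bsub>V\<^esub> w0 \<in> span (insert w0 B)"
          using B(4) span_is_monotone[of B "insert w0 B"] by blast
        moreover have "c \<odot>\<^bsub>V\<^esub> w0 \<in> span (insert w0 B)"
          using in_own_span[OF BV] by auto
        ultimately have "w \<oplus>\<^bsub>V\<^esub> (- c) \<odot>\<^bsub>V\<^esub> w0 \<oplus>\<^bsub>V\<^esub> c \<odot>\<^bsub>V\<^esub> w0 \<in> span (insert w0 B)"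
          by (rule S.m_closed)
        moreover have "(- c) \<odot>\<^bsub>V\<^esub> w0 \<oplus>\<^bsub>V\<^esub> c \<odot>\<^bsub>V\<^esub> w0 = \<zero>\<^bsub>V\<^esub>"
          using smult_l_distr[of "- c" c w0] lmult_0[of w0] w0 WV by (auto simp: subset_iff)
        ultimately show ?thesis using w w0 WV by (simp add: M.a_assoc subset_iff)
      qed
      then show ?thesis using B w0 insert.hyps
        by (intro exI[of _ "insert w0 B"]) (auto simp: card_insert_if)
    qed
  qed
  obtain B where B: "finite B" "card B \<le> card D" "B \<subseteq> carrier V" "carrier V \<subseteq> span B"
    using span[of D "carrier V"] finD lin sep by auto
  then have gen: "gen_set B" using span_is_subset2[of B] by auto
  show "fin_dim" using B gen unfolding fin_dim_def by blast
  show "dim \<le> card D" using gen_ge_dim[of B] B gen by simp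
qed

subsection \<open>Monomial ideals and their tangent spaces\<close>

lemma lookup_single_times:
  fixes f :: "'a::cancel_comm_monoid_add \<Rightarrow>\<^sub>0 'b::comm_semiring_1"
  shows "Poly_Mapping.lookup (Poly_Mapping.single w a * f) (w + v) = a * Poly_Mapping.lookup f v"
  by (simp add: lookup_mult lookup_single when_mult)

lemma lookup_single_times_eq_0:
  fixes f :: "'a::cancel_comm_monoid_add \<Rightarrow>\<^sub>0 'b::comm_semiring_1"
  assumes "\<And>v'. v \<noteq> w + v'"
  shows "Poly_Mapping.lookup (Poly_Mapping.single w a * f) v = 0"
proof -
  have "v \<notin> Poly_Mapping.keys (Poly_Mapping.single w a * f)"
    using keys_mult[of "Poly_Mapping.single w a" f] assms by (auto split: if_splits)
  then show ?thesis by (simp add: in_keys_iff)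
qed

lemma update_eq_add:
  fixes f :: "'a \<Rightarrow>\<^sub>0 'b::comm_monoid_add"
  shows "a \<notin> Poly_Mapping.keys f \<Longrightarrow> Poly_Mapping.update a b f = Poly_Mapping.single a b + f"
  by (rule poly_mapping_eqI) (auto simp: lookup_update lookup_add lookup_single in_keys_iff)

lemma pow_single: "Poly_Mapping.single u (1 :: complex) ^ n = Poly_Mapping.single ((\<lambda>(a, b, c). (n * a, n * b, n * c)) u) 1"
  for u :: exponent
  by (induction n) (auto simp: mult_single split: prod.splits simp flip: zero_prod_def)

lemma varX_power: "varX ^ n = Poly_Mapping.single (n, 0, 0) 1"
  and varY_power: "varY ^ n = Poly_Mapping.single (0, n, 0) 1"
  and varZ_power: "varZ ^ n = Poly_Mapping.single (0, 0, n) 1"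
  by (simp_all add: varX_def varY_def varZ_def pow_single)

lemma monomials_eq: "monomials = range (\<lambda>u. Poly_Mapping.single u 1)"
  by (auto simp: monomials_def varX_power varY_power varZ_power mult_single image_iff)

lemma single_dvd_single_iff:
  fixes u v :: exponent
  shows "Poly_Mapping.single u (1 :: complex) dvd Poly_Mapping.single v 1 \<longleftrightarrow> (\<exists>w. v = u + w)"
proof
  assume "Poly_Mapping.single u (1 :: complex) dvd Poly_Mapping.single v 1"
  then obtain f where f: "Poly_Mapping.single v 1 = Poly_Mapping.single u (1 :: complex) * f" ..
  show "\<exists>w. v = u + w"
  proof (rule ccontr)
    assume "\<not> ?thesis"
    then have "Poly_Mapping.lookup (Poly_Mapping.single u (1 :: complex) * f) v = 0"
      by (intro lookup_single_times_eq_0) auto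
    then show False by (simp add: f[symmetric])
  qed
next
  assume "\<exists>w. v = u + w"
  then show "Poly_Mapping.single u (1 :: complex) dvd Poly_Mapping.single v 1"
    by (metis dvd_triv_left mult.right_neutral mult_single)
qed

definition exponents :: "pol set \<Rightarrow> exponent set" where
  "exponents I = {u. Poly_Mapping.single u 1 \<in> I}"

text \<open>
  For a monomial ideal this does not depend on the chosen representative as long as \<open>v\<close> is not an
  exponent of the ideal.
\<close>

definition coset_coeff :: "exponent \<Rightarrow> pol set \<Rightarrow> complex" where
  "coset_coeff v A = Poly_Mapping.lookup (SOME f. f \<in> A) v"

locale pol_ideal = ideal I polR for I
begin

lemma zero_mem: "0 \<in> I"
  using additive_subgroup.zero_closed[OF is_additive_subgroup] by simp

lemma exponents_add: "u \<in> exponents I \<Longrightarrow> u + w \<in> exponents I"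
  using I_l_closed[of "Poly_Mapping.single u 1" "Poly_Mapping.single w 1"]
  by (simp add: exponents_def mult_single add.commute)

lemma single_mem: "u \<in> exponents I \<Longrightarrow> Poly_Mapping.single u a \<in> I"
  using I_l_closed[of "Poly_Mapping.single u 1" "Poly_Mapping.single 0 a"]
  by (simp add: exponents_def mult_single)

lemma mem_if_keys: "Poly_Mapping.keys f \<subseteq> exponents I \<Longrightarrow> f \<in> I"
proof (induction f rule: update_induct)
  case const
  then show ?case by (simp add: zero_mem)
next
  case (update f a b)
  then have "a \<in> exponents I" "f \<in> I" by (auto simp: keys_update)
  then show ?case
    using additive_subgroup.a_closed[OF is_additive_subgroup, of "Poly_Mapping.single a b" f] single_mem[of a b] update.hyps
    by (simp add: update_eq_add)
qed

lemma coset_eq: "I +>\<^bsub>polR\<^esub> f = (\<lambda>h. h + f) ` I"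
  by (auto simp: a_r_coset_def')

lemma carrier_quot_module: "carrier (quot_module I) = range (\<lambda>f. I +>\<^bsub>polR\<^esub> f)"
  by (auto simp: quot_module_def FactRing_def A_RCOSETS_def')

lemma add_quot_module:
  "(I +>\<^bsub>polR\<^esub> f) \<oplus>\<^bsub>quot_module I\<^esub> (I +>\<^bsub>polR\<^esub> g) = I +>\<^bsub>polR\<^esub> (f + g)"
  using a_rcos_sum[of f g] by (simp add: quot_module_def FactRing_def)

lemma smult_quot_module:
  "f \<odot>\<^bsub>quot_module I\<^esub> (I +>\<^bsub>polR\<^esub> g) = I +>\<^bsub>polR\<^esub> (f * g)"
  using rcoset_mult_add[of f g] by (simp add: quot_module_def FactRing_def)

lemma zero_quot_module: "\<zero>\<^bsub>quot_module I\<^esub> = I"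
  by (simp add: quot_module_def FactRing_def)

lemma coset_mem_eq: "f \<in> I \<Longrightarrow> I +>\<^bsub>polR\<^esub> f = I"
  by (rule a_rcos_const)

end

locale monomial_pol_ideal = pol_ideal +
  assumes monomial: "monomial_ideal I"
begin

text \<open>The polynomials supported on \<open>exponents I\<close> form an ideal containing the
  generating monomials, so the generated ideal lies inside it.\<close>

lemma mem_iff_keys: "f \<in> I \<longleftrightarrow> Poly_Mapping.keys f \<subseteq> exponents I"
proof
  assume f: "f \<in> I"
  obtain A where A: "A \<subseteq> monomials" "I = genideal polR A"
    using monomial by (auto simp: monomial_ideal_def)
  have "A \<subseteq> I" using A genideal_self[of A] by simp
  define J where "J = {f :: pol. Poly_Mapping.keys f \<subseteq> exponents I}"
  have "ideal J polR"
  proof (rule idealI)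
    show "ring (polR :: pol ring)" by (rule ring_axioms)
    show "subgroup J (add_monoid polR)"
    proof (rule group.subgroupI)
      show "group (add_monoid polR)" by (rule a_group)
      show "J \<noteq> {}" by (auto simp: J_def intro!: exI[of _ 0])
    next
      fix f assume "f \<in> J"
      then have "- f \<in> J" by (auto simp: J_def in_keys_iff)
      moreover have "\<ominus>\<^bsub>polR\<^esub> f = - f" by (simp add: class_ring_simps)
      ultimately show "inv\<^bsub>add_monoid polR\<^esub> f \<in> J" by (simp add: a_inv_def)
    next
      fix f g assume "f \<in> J" "g \<in> J"
      then show "f \<otimes>\<^bsub>add_monoid polR\<^esub> g \<in> J"
        using keys_add[of f g] by (auto simp: J_def)
    qed simp
  next
    have J: "f * g \<in> J" if "f \<in> J" for f g
      using that keys_mult[of f g] exponents_add by (force simp: J_def)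
    then show "f \<in> J \<Longrightarrow> f \<otimes>\<^bsub>polR\<^esub> g \<in> J" "f \<in> J \<Longrightarrow> g \<otimes>\<^bsub>polR\<^esub> f \<in> J" for f g
      by (simp_all add: mult.commute)
  qed
  moreover have "A \<subseteq> J"
  proof
    fix h assume "h \<in> A"
    then have "h \<in> range (\<lambda>u. Poly_Mapping.single u 1)" "h \<in> I"
      using A(1) \<open>A \<subseteq> I\<close> unfolding monomials_eq by blast+
    then obtain u where "h = Poly_Mapping.single u 1" "h \<in> I" by blast
    then show "h \<in> J" by (simp add: J_def exponents_def)
  qed
  ultimately have "I \<subseteq> J" unfolding A(2) by (rule genideal_minimal)
  then show "Poly_Mapping.keys f \<subseteq> exponents I" using f by (auto simp: J_def)
qed (rule mem_if_keys)

lemma coset_coeff: "v \<notin> exponents I \<Longrightarrow> coset_coeff v (I +>\<^bsub>polR\<^esub> f) = Poly_Mapping.lookup f v"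
proof -
  assume v: "v \<notin> exponents I"
  have "f \<in> I +>\<^bsub>polR\<^esub> f" using a_rcos_self by simp
  then have "(SOME g. g \<in> I +>\<^bsub>polR\<^esub> f) \<in> I +>\<^bsub>polR\<^esub> f" by (rule someI)
  then obtain h where "h \<in> I" "(SOME g. g \<in> I +>\<^bsub>polR\<^esub> f) = h + f"
    unfolding coset_eq by blast
  then show ?thesis
    using v mem_iff_keys[of h] by (auto simp: coset_coeff_def lookup_add in_keys_iff)
qed

lemma coset_eqI:
  assumes "\<And>v. v \<notin> exponents I \<Longrightarrow> Poly_Mapping.lookup f v = 0"
  shows "I +>\<^bsub>polR\<^esub> f = I"
  using assms by (intro coset_mem_eq mem_if_keys) (auto simp: in_keys_iff)

lemma coset_coeff_linear:
  assumes "v \<notin> exponents I"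
  shows "linear_functional (complex_space (quot_module I)) (coset_coeff v)"
  using assms lookup_single_times[of 0 _ _ v, where 'b = complex]
  by (auto simp: linear_functional_def complex_space_def carrier_quot_module add_quot_module
      smult_quot_module coset_coeff lookup_add)

text \<open>Coefficients at exponents outside the ideal separate cosets, whence finite dimension,
  and are dual to the cosets of the corresponding monomials.\<close>

lemma card_le_colength:
  assumes "finite (- exponents I)"
  shows "card (- exponents I) \<le> colength I"
proof -
  have vs: "vectorspace complexK (complex_space (quot_module I))"
    by (rule vectorspace_quotient) (rule is_ideal)
  have "vectorspace.fin_dim complexK (complex_space (quot_module I))"
  proof (rule dim_le_of_separating_functionals(1)[OF vs coset_coeff_linear assms])
    fix A assume A: "A \<in> carrier (complex_space (quot_module I))"
      and 0: "\<And>d. d \<in> - exponents I \<Longrightarrow> coset_coeff d A = 0"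
    then obtain f where f: "A = I +>\<^bsub>polR\<^esub> f"
      by (auto simp: complex_space_def carrier_quot_module)
    show "A = \<zero>\<^bsub>complex_space (quot_module I)\<^esub>"
      using 0 unfolding f by (simp add: complex_space_def zero_quot_module coset_coeff coset_eqI)
  qed auto
  then show ?thesis
    unfolding colength_def
    by (rule dim_ge_of_dual_family[OF vs _ coset_coeff_linear assms,
          where e = "\<lambda>u. I +>\<^bsub>polR\<^esub> Poly_Mapping.single u 1"])
       (auto simp: complex_space_def carrier_quot_module coset_coeff lookup_single)
qed

section \<open>Coefficients of a tangent vector\<close>

definition hom_coeff :: "(pol \<Rightarrow> pol set) \<Rightarrow> exponent \<Rightarrow> exponent \<Rightarrow> complex" where
  "hom_coeff \<phi> u v = coset_coeff v (\<phi> (Poly_Mapping.single u 1))"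

lemma tangent_spaceD:
  assumes "\<phi> \<in> carrier (tangent_space I)"
  shows "f \<in> I \<Longrightarrow> \<exists>g. \<phi> f = I +>\<^bsub>polR\<^esub> g"
    and "f \<in> I \<Longrightarrow> g \<in> I \<Longrightarrow> \<phi> (f + g) = \<phi> f \<oplus>\<^bsub>quot_module I\<^esub> \<phi> g"
    and "f \<in> I \<Longrightarrow> \<phi> (r * f) = r \<odot>\<^bsub>quot_module I\<^esub> \<phi> f"
    and "\<phi> \<in> extensional I"
  using assms
  by (auto simp: tangent_space_def complex_space_def hom_module_def ideal_module_def
      LinearCombinations.module_hom_def carrier_quot_module Pi_iff image_iff)

lemma hom_coeff_linear:
  assumes "u \<in> exponents I" "v \<notin> exponents I"
  shows "linear_functional (tangent_space I) (\<lambda>\<phi>. hom_coeff \<phi> u v)"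
proof -
  note lin = coset_coeff_linear[OF assms(2), unfolded linear_functional_def complex_space_def, simplified]
  have u: "Poly_Mapping.single u 1 \<in> I" using assms(1) by (simp add: exponents_def)
  have carr: "\<phi> (Poly_Mapping.single u 1) \<in> carrier (quot_module I)"
    if "\<phi> \<in> carrier (tangent_space I)" for \<phi>
    using tangent_spaceD(1)[OF that u] by (auto simp: carrier_quot_module)
  show ?thesis
    using u lin carr
    by (simp add: linear_functional_def hom_coeff_def)
       (simp add: tangent_space_def complex_space_def hom_module_def ideal_module_def)
qed

text \<open>A single representative \<open>g\<close> of the image of \<open>x^u\<close> serves all
  multiples of \<open>x^u\<close>; both axioms of \<open>staircase_hom\<close> are read off from
  it.\<close>

lemma hom_coeff_add_exponent:
  assumes \<phi>: "\<phi> \<in> carrier (tangent_space I)" and u: "u \<in> exponents I"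
  obtains g where "\<And>v. v \<notin> exponents I \<Longrightarrow> hom_coeff \<phi> u v = Poly_Mapping.lookup g v"
    "\<And>w v. v \<notin> exponents I \<Longrightarrow> hom_coeff \<phi> (u + w) v = Poly_Mapping.lookup (Poly_Mapping.single w 1 * g) v"
proof -
  have u': "Poly_Mapping.single u 1 \<in> I" using u by (simp add: exponents_def)
  obtain g where g: "\<phi> (Poly_Mapping.single u 1) = I +>\<^bsub>polR\<^esub> g"
    using tangent_spaceD(1)[OF \<phi> u'] by blast
  have "\<phi> (Poly_Mapping.single (u + w) 1) = I +>\<^bsub>polR\<^esub> (Poly_Mapping.single w 1 * g)" for w
    using tangent_spaceD(3)[OF \<phi> u', of "Poly_Mapping.single w 1"] g
    by (simp add: mult_single smult_quot_module add.commute)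
  with g show ?thesis by (intro that[of g]) (auto simp: hom_coeff_def coset_coeff)
qed

lemma tangent_eq_zeroI:
  assumes \<phi>: "\<phi> \<in> carrier (tangent_space I)"
    and zero: "\<And>u v. u \<in> exponents I \<Longrightarrow> v \<notin> exponents I \<Longrightarrow> hom_coeff \<phi> u v = 0"
  shows "\<phi> = \<zero>\<^bsub>tangent_space I\<^esub>"
proof -
  have single: "\<phi> (Poly_Mapping.single u a) = I" if u: "u \<in> exponents I" for u a
  proof -
    have u': "Poly_Mapping.single u 1 \<in> I" using u by (simp add: exponents_def)
    obtain g where g: "\<phi> (Poly_Mapping.single u 1) = I +>\<^bsub>polR\<^esub> g"
      using tangent_spaceD(1)[OF \<phi> u'] by blast
    have "Poly_Mapping.lookup g v = 0" if "v \<notin> exponents I" for v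
      using zero[OF u that] that by (simp add: hom_coeff_def g coset_coeff)
    then have "I +>\<^bsub>polR\<^esub> (Poly_Mapping.single 0 a * g) = I"
      using lookup_single_times[of 0 a g] by (intro coset_eqI) simp
    then show ?thesis
      using tangent_spaceD(3)[OF \<phi> u', of "Poly_Mapping.single 0 a"] g
      by (simp add: mult_single smult_quot_module)
  qed
  have "Poly_Mapping.keys f \<subseteq> exponents I \<Longrightarrow> \<phi> f = I" for f
  proof (induction f rule: update_induct)
    case const
    obtain g where "\<phi> 0 = I +>\<^bsub>polR\<^esub> g" using tangent_spaceD(1)[OF \<phi> zero_mem] by auto
    then show ?case
      using tangent_spaceD(3)[OF \<phi> zero_mem, of 0] coset_mem_eq[OF zero_mem]
      by (simp add: smult_quot_module)
  next
    case (update f a b)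
    then have "Poly_Mapping.keys f \<subseteq> exponents I" and a: "a \<in> exponents I"
      by (auto simp: keys_update)
    then have f: "\<phi> f = I" "f \<in> I" using update.IH mem_if_keys by auto
    have "I \<oplus>\<^bsub>quot_module I\<^esub> I = I"
      using add_quot_module[of 0 0] coset_mem_eq[OF zero_mem] by simp
    then show ?case
      using tangent_spaceD(2)[OF \<phi> single_mem[OF a] f(2), of b] f(1) single[OF a, of b] update.hyps
      by (simp add: update_eq_add)
  qed
  then have "\<phi> f = I" if "f \<in> I" for f using that mem_iff_keys by blast
  then show ?thesis
    using tangent_spaceD(4)[OF \<phi>]
    by (intro extensionalityI[of _ I])
       (auto simp: tangent_space_def complex_space_def hom_module_def ideal_module_def zero_quot_module)
qed

end


section \<open>Borel moves on all monomials of the ideal\<close>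

lemma (in pol_ideal) min_gen_below:
  assumes "u \<in> exponents I"
  obtains g w where "u = g + w" "Poly_Mapping.single g 1 \<in> min_gens I"
proof -
  define size where "size = (\<lambda>(a, b, c). a + b + c :: nat)"
  have size_add: "size (v + w) = size v + size w" for v w
    by (auto simp: size_def split: prod.splits)
  have size_0: "size w = 0 \<longleftrightarrow> w = 0" for w
    by (auto simp: size_def zero_prod_def split: prod.splits)
  let ?P = "\<lambda>g. g \<in> exponents I \<and> (\<exists>w. u = g + w)"
  \<comment> \<open>A divisor of least total degree inside the ideal is a minimal generator.\<close>
  define g where "g = arg_min size ?P"
  have "?P u" using assms by (metis add.right_neutral)
  then have g: "?P g" unfolding g_def by (rule arg_min_natI)
  have least: "size g \<le> size h" if "?P h" for h
    unfolding g_def using that by (rule arg_min_nat_le)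
  from g obtain w where w: "u = g + w" by blast
  have "h = Poly_Mapping.single g 1"
    if h: "h \<in> monomials" "h \<in> I" "h dvd Poly_Mapping.single g 1" for h
  proof -
    obtain v where v: "h = Poly_Mapping.single v 1" using h(1) by (auto simp: monomials_eq)
    then obtain w' where w': "g = v + w'" using h(3) by (auto simp: single_dvd_single_iff)
    have "u = v + (w' + w)" by (simp add: w w' add.assoc)
    then have "?P v" using h(2) v unfolding exponents_def by blast
    then have "size w' = 0" using least[of v] w' by (simp add: size_add)
    then show ?thesis using w' v by (simp add: size_0)
  qed
  then have "Poly_Mapping.single g 1 \<in> min_gens I"
    using g by (auto simp: min_gens_def monomials_eq exponents_def)
  with w show ?thesis by (rule that)
qed

text \<open>The traded variable divides either a minimal generator below the monomial, where the
  hypothesis applies, or the cofactor, which may be changed freely.\<close>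

lemma (in pol_ideal) borel_fixed_exponents:
  assumes "borel_fixed I"
  shows "(i, p, Suc c) \<in> exponents I \<Longrightarrow> (i, Suc p, c) \<in> exponents I"
    and "(i, Suc p, c) \<in> exponents I \<Longrightarrow> (Suc i, p, c) \<in> exponents I"
proof -
  have move: "varZ * h \<in> min_gens I \<Longrightarrow> varY * h \<in> I" "varY * h \<in> min_gens I \<Longrightarrow> varX * h \<in> I" for h
    using assms by (auto simp: borel_fixed_def)
  show "(i, Suc p, c) \<in> exponents I" if mem: "(i, p, Suc c) \<in> exponents I"
  proof -
    obtain g w where gw: "(i, p, Suc c) = g + w" "Poly_Mapping.single g 1 \<in> min_gens I"
      using mem by (rule min_gen_below)
    obtain a b k a' b' k' where g: "g = (a, b, k)" and w: "w = (a', b', k')"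
      by (metis prod.collapse)
    show ?thesis
    proof (cases k)
      case 0
      then have "(i, Suc p, c) = g + (a', Suc b', c)" using gw g w by simp
      moreover have "g \<in> exponents I" using gw by (simp add: min_gens_def exponents_def)
      ultimately show ?thesis using exponents_add by simp
    next
      case (Suc k0)
      then have "(a, Suc b, k0) \<in> exponents I"
        using move(1)[of "Poly_Mapping.single (a, b, k0) 1"] gw(2)
        by (simp add: g varY_def varZ_def mult_single exponents_def)
      then show ?thesis using exponents_add[of "(a, Suc b, k0)" w] gw(1) g w Suc by simp
    qed
  qed
  show "(Suc i, p, c) \<in> exponents I" if mem: "(i, Suc p, c) \<in> exponents I"
  proof -
    obtain g w where gw: "(i, Suc p, c) = g + w" "Poly_Mapping.single g 1 \<in> min_gens I"
      using mem by (rule min_gen_below)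
    obtain a b k a' b' k' where g: "g = (a, b, k)" and w: "w = (a', b', k')"
      by (metis prod.collapse)
    show ?thesis
    proof (cases b)
      case 0
      then have "(Suc i, p, c) = g + (Suc a', p, k')" using gw g w by simp
      moreover have "g \<in> exponents I" using gw by (simp add: min_gens_def exponents_def)
      ultimately show ?thesis using exponents_add by simp
    next
      case (Suc b0)
      then have "(Suc a, b0, k) \<in> exponents I"
        using move(2)[of "Poly_Mapping.single (a, b0, k) 1"] gw(2)
        by (simp add: g varX_def varY_def mult_single exponents_def)
      then show ?thesis using exponents_add[of "(Suc a, b0, k)" w] gw(1) g w Suc by simp
    qed
  qed
qed

section \<open>The bound on the tangent space\<close>

theorem theorem1:
  fixes k \<Delta> l m1 m2 m3 :: nat and I :: "pol set"
  assumes "k \<ge> 1"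
    and "\<Delta> \<le> (k + 2 choose 2) - 1"
    and "l = (k + 2 choose 3) + \<Delta>"
    and "zero_dimensional I"
    and "borel_fixed I"
    and "colength I = l"
    and "varX ^ m1 \<in> min_gens I"
    and "varY ^ m2 \<in> min_gens I"
    and "varZ ^ m3 \<in> min_gens I"
  shows "vectorspace.fin_dim complexK (tangent_space I) \<and>
    int (tangent_dim I) \<le> (2 * int m1 + 1) * int l - 2 * int (m1 + 2 choose 4)"
proof -
  have ideal: "ideal I polR" using assms(4) by (simp add: zero_dimensional_def)
  interpret monomial_pol_ideal I
    using ideal assms(5)
    by (simp add: monomial_pol_ideal_def monomial_pol_ideal_axioms_def pol_ideal_def borel_fixed_def)
  have pure: "(m1, 0, 0) \<in> exponents I" "(0, m2, 0) \<in> exponents I" "(0, 0, m3) \<in> exponents I"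
    using assms(7-9) by (simp_all add: min_gens_def exponents_def varX_power varY_power varZ_power)
  interpret borel_staircase "exponents I" m1 m2 m3
  proof
    show "(i, 0, 0) \<in> exponents I \<longleftrightarrow> m1 \<le> i" for i
    proof
      assume i: "(i, 0, 0) \<in> exponents I"
      \<comment> \<open>A smaller power of \<open>x\<close> in the ideal would divide the minimal
        generator \<open>varX ^ m1\<close> and hence equal it, but the supports differ.\<close>
      show "m1 \<le> i"
      proof (rule ccontr)
        assume "\<not> m1 \<le> i"
        then have "(m1, 0, 0) = (i, 0, 0) + ((m1 - i, 0, 0) :: exponent)" by simp
        then have "Poly_Mapping.single (i, 0, 0) (1 :: complex) dvd varX ^ m1"
          unfolding varX_power single_dvd_single_iff by blast
        moreover have "Poly_Mapping.single (i, 0, 0) 1 \<in> I" using i by (simp add: exponents_def)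
        ultimately have "Poly_Mapping.single (i, 0, 0) 1 = varX ^ m1"
          using assms(7) by (auto simp: min_gens_def monomials_eq)
        then have "Poly_Mapping.keys (Poly_Mapping.single (i, 0, 0) (1 :: complex)) =
            Poly_Mapping.keys (varX ^ m1)" by simp
        then show False using \<open>\<not> m1 \<le> i\<close> by (simp add: varX_power)
      qed
    next
      assume "m1 \<le> i"
      then show "(i, 0, 0) \<in> exponents I" using exponents_add[OF pure(1), of "(i - m1, 0, 0)"] by simp
    qed
  qed (use exponents_add borel_fixed_exponents[OF assms(5)] pure in auto)
  have vs: "vectorspace complexK (tangent_space I)" by (rule vectorspace_tangent_space[OF ideal])
  have mem: "u \<in> exponents I" "v \<notin> exponents I" if "(u, v) \<in> probes" for u v
    using that probes_subset by auto
  have sep: "\<phi> = \<zero>\<^bsub>tangent_space I\<^esub>"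
    if \<phi>: "\<phi> \<in> carrier (tangent_space I)"
      and 0: "\<And>d. d \<in> probes \<Longrightarrow> (\<lambda>(u, v) \<phi>. hom_coeff \<phi> u v) d \<phi> = 0" for \<phi>
  proof -
    \<comment> \<open>Both axioms compare coefficients in the image of \<open>x^(u + w)\<close>,
      which is \<open>x^w\<close> times the image of \<open>x^u\<close>.\<close>
    interpret staircase_hom "exponents I" m1 m2 m3 "hom_coeff \<phi>"
    proof
      fix u v w assume u: "u \<in> exponents I"
      obtain g where g: "\<And>v. v \<notin> exponents I \<Longrightarrow> hom_coeff \<phi> u v = Poly_Mapping.lookup g v"
          "\<And>w v. v \<notin> exponents I \<Longrightarrow>
            hom_coeff \<phi> (u + w) v = Poly_Mapping.lookup (Poly_Mapping.single w 1 * g) v"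
        using hom_coeff_add_exponent[OF \<phi> u] by blast
      show "hom_coeff \<phi> (u + w) (v + w) = hom_coeff \<phi> u v" if "v + w \<notin> exponents I"
      proof -
        have "v \<notin> exponents I" using that exponents_add by blast
        then show ?thesis
          using g(1)[of v] g(2)[OF that, of w] lookup_single_times[of w 1 g v] by (simp add: add.commute)
      qed
      show "hom_coeff \<phi> (u + w) v = 0" if "v \<notin> exponents I" "\<And>v'. v \<noteq> v' + w"
        using g(2)[OF that(1), of w] lookup_single_times_eq_0[of v w 1 g] that(2)
        by (metis add.commute)
    qed
    have "hom_coeff \<phi> u v = 0" if "(u, v) \<in> probes" for u v
      using 0[OF that] by simp
    from probes_determine[OF this] show ?thesis by (rule tangent_eq_zeroI[OF \<phi>])
  qed
  have lin: "linear_functional (tangent_space I) ((\<lambda>(u, v) \<phi>. hom_coeff \<phi> u v) d)"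
    if "d \<in> probes" for d
    using hom_coeff_linear[OF mem] that by (cases d) auto
  have "vectorspace.fin_dim complexK (tangent_space I)" "tangent_dim I \<le> card probes"
    unfolding tangent_dim_def
    by (rule dim_le_of_separating_functionals[OF vs lin finite_probes sep]; assumption)+
  moreover have "card probes + 2 * ((m1 + 2) choose 4) \<le> (2 * m1 + 1) * l"
    using card_probes mult_le_mono2[OF card_le_colength[OF finite_compl], of "2 * m1 + 1"]
    unfolding assms(6) by (rule le_trans)
  ultimately have "tangent_dim I + 2 * ((m1 + 2) choose 4) \<le> (2 * m1 + 1) * l" by linarith
  \<comment> \<open>The additive form passes to integers before the binomial is subtracted, which
    avoids truncation.\<close>
  then have "int (tangent_dim I + 2 * ((m1 + 2) choose 4)) \<le> int ((2 * m1 + 1) * l)"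
    by (simp only: of_nat_le_iff)
  then have "int (tangent_dim I) \<le> (2 * int m1 + 1) * int l - 2 * int (m1 + 2 choose 4)"
    by (simp only: of_nat_add of_nat_mult of_nat_numeral of_nat_1)
  with \<open>vectorspace.fin_dim complexK (tangent_space I)\<close> show ?thesis by blast
qed

end
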